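(* Let $X$ be a random variable with $X\ge 0$ and $a:=\mathbb{E}X\in(0,\infty)$. If $X$ is infinitely divisible, then there exists a distribution for a random variable $Y$ such that $$X^*=^d X+Y,\quad\text{with } X \text{ and } Y \text{ independent}.\qquad (\star)$$ Conversely, if $(\star)$ holds for some random variable $Y$, then $X$ is infinitely divisible. In either case, the distribution of $Y$ is unique, $\mathbb{P}(Y\ge 0)=1$, and, writing $\alpha$ for the distribution of $Y$ (a probability measure on $[0,\infty)$), the characteristic function $\phi(u)=\mathbb{E}e^{iuX}$ of $X$ is given, for all $u\in\mathbb{R}$, by $$\phi(u)=\exp\left(a\left(iu\,\alpha(\{0\})+\int_{(0,\infty)}\frac{e^{iuy}-1}{y}\,\alpha(dy)\right)\right).$$
   Context: For a nonnegative random variable $X$ with $a:=\mathbb{E}X\in(0,\infty)$, $X^*$ denotes a random variable with the size biased distribution of $X$: the law of $X^*$ is absolutely continuous with respect to the law of $X$ with Radon-Nikodym derivative $x/a$; equivalently $\mathbb{E}g(X^* )=\frac1a\mathbb{E}(Xg(X))$ for all bounded measurable $g$. $X$ is infinitely divisible if for each $n\ge1$ there is a distribution such that if $X_1^{(n)},\dots,X_n^{(n)}$ are i.i.d. with this distribution then $X=^d X_1^{(n)}+\cdots+X_n^{(n)}$. $=^d$ denotes equality in distribution. *)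

theory Defs
  imports "HOL-Probability.Probability"
begin

text \<open>
  The law of \<open>X*\<close> as a function of the law \<open>\<mu>\<close> of \<open>X\<close>.  It is meant for probability measures
  concentrated on \<open>[0,\<infinity>)\<close> with mean in \<open>(0,\<infinity>)\<close>; otherwise \<open>ennreal\<close> cuts off negative values of
  the density.
\<close>

definition size_biased :: "real measure \<Rightarrow> real measure" where
  "size_biased \<mu> = density \<mu> (\<lambda>x. ennreal (x / (\<integral>t. t \<partial>\<mu>)))"

text \<open>
  Infinite divisibility of a law \<open>\<mu>\<close>.  The law of a sum of i.i.d. variables depends only on their
  common law \<open>\<nu>\<close>, so it is the same to ask for one i.i.d. family or for all of them.  Fixing the type
  of the sample points is no restriction either: \<open>\<Pi>\<^sub>M i\<in>{..<n}. \<nu>\<close> is a measure on \<open>nat \<Rightarrow> real\<close>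
  whose coordinates are such a family.
\<close>

definition infinitely_divisible :: "real measure \<Rightarrow> bool" where
  "infinitely_divisible \<mu> \<longleftrightarrow>
     (\<forall>n::nat. 1 \<le> n \<longrightarrow> (\<exists>\<nu> :: real measure. \<exists>(N :: (nat \<Rightarrow> real) measure) Z.
        prob_space N \<and>
        prob_space.indep_vars N (\<lambda>_. borel) Z {..<n} \<and>
        (\<forall>i<n. distr N borel (Z i) = \<nu>) \<and>
        distr N borel (\<lambda>\<omega>. \<Sum>i<n. Z i \<omega>) = \<mu>))"

text \<open>
  \<open>X* =\<^sup>d X + Y\<close> with \<open>X\<close> and \<open>Y\<close> independent, for a law \<open>\<mu>\<close> of \<open>X\<close>.  The space on which the original
  \<open>X\<close> lives need not carry an independent \<open>Y\<close>, so \<open>X\<close> is replaced by a copy \<open>X'\<close> on \<open>N\<close>.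
\<close>

definition size_bias_decomposition ::
    "real measure \<Rightarrow> 'b measure \<Rightarrow> ('b \<Rightarrow> real) \<Rightarrow> ('b \<Rightarrow> real) \<Rightarrow> bool" where
  "size_bias_decomposition \<mu> N X' Y \<longleftrightarrow>
     prob_space N \<and>
     prob_space.indep_var N borel X' borel Y \<and>
     distr N borel X' = \<mu> \<and>
     size_biased \<mu> = distr N borel (\<lambda>\<omega>. X' \<omega> + Y \<omega>)"

end

theory Submission
  imports Defs
begin

text \<open>
  Everything is read off characteristic functions.  Let \<open>\<phi>\<close> be the characteristic function of the law
  \<open>\<mu>\<close> of \<open>X\<close>, and \<open>\<psi>\<close> that of a law \<open>\<alpha>\<close>.  Since \<open>\<phi>' u = E (\<i> X e\<^sup>i\<^sup>u\<^sup>X)\<close>, the size biased law has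
  characteristic function \<open>\<phi>' / (\<i> a)\<close>.  Hence the size biased law is that of an independent sum of
  \<open>X\<close> and a variable \<open>Y\<close> with law \<open>\<alpha>\<close> exactly when \<open>\<phi>' = \<i> a \<phi> \<psi>\<close>, that is, when \<open>\<phi> = exp (a K)\<close> for the
  antiderivative \<open>K\<close> of \<open>\<i> \<psi>\<close> with \<open>K 0 = 0\<close> (\<open>char_eq_exp_jump_exponent\<close>).  Integrating \<open>\<i> e\<^sup>i\<^sup>v\<^sup>y\<close> over
  \<open>v\<close> shows that \<open>K\<close> is the exponent in the asserted formula; in particular \<open>\<phi>\<close> has no zeros, so \<open>\<psi>\<close> is
  determined by \<open>\<phi>\<close> and \<open>\<alpha>\<close> is unique.

  That \<open>Y \<ge> 0\<close> almost surely (\<open>size_bias_decomposition_nonneg\<close>) is seen from lower bounds: if \<open>Y < - e\<close>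
  had positive probability, every almost sure lower bound \<open>c\<close> of \<open>X\<close> could be improved to \<open>c + e\<close>.

  For infinite divisibility it remains to see that \<open>exp ((a / n) K)\<close> is a characteristic function
  (\<open>exp_jump_exponent_is_char\<close>).  It is a limit of characteristic functions of sums of
  nonnegative i.i.d. variables whose number grows while the total mean stays fixed.  The fixed mean gives tightness, and the Helly
  selection theorem provides a limit law.

  Conversely, let \<open>\<mu>\<close> be the \<open>n\<close>-fold convolution of \<open>\<nu>\<^sub>n\<close>.  Size biasing the sum amounts to size
  biasing one summand, and this relates \<open>\<mu>\<close>, \<open>\<nu>\<^sub>n\<close> and their size biased versions
  (\<open>char_size_biased_of_root\<close>).  As \<open>n\<close> grows, \<open>\<nu>\<^sub>n\<close> tends to the point mass at \<open>0\<close>, while the size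
  biased \<open>\<nu>\<^sub>n\<close> are tight, because their tails are bounded by the tail of the size biased \<open>\<mu>\<close>.  Any
  weak limit of them is the required law \<open>\<alpha>\<close>
  (\<open>size_bias_factor_if_infinitely_divisible\<close>).
\<close>

section \<open>Differentiating characteristic functions\<close>

text \<open>
  The Lipschitz bound makes \<open>w\<close> dominate all difference quotients, so dominated convergence along
  an arbitrary sequence tending to \<open>u\<close> gives the derivative.
\<close>

lemma has_vector_derivative_integral:
  fixes f :: "real \<Rightarrow> 'a \<Rightarrow> complex" and w :: "'a \<Rightarrow> real"
  assumes int: "\<And>v. integrable M (f v)"
    and f': "f' \<in> borel_measurable M"
    and w: "integrable M w"
    and deriv: "\<And>x. ((\<lambda>v. f v x) has_vector_derivative f' x) (at u)"
    and lip: "\<And>v x. norm (f v x - f u x) \<le> \<bar>v - u\<bar> * w x"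
  shows "((\<lambda>v. \<integral>x. f v x \<partial>M) has_vector_derivative (\<integral>x. f' x \<partial>M)) (at u)"
proof -
  have quot: "(F has_vector_derivative D) (at u) \<longleftrightarrow>
      (\<forall>s. (\<forall>i. s i \<noteq> u) \<longrightarrow> s \<longlonglongrightarrow> u \<longrightarrow>
         (\<lambda>i. (F (s i) - F u) /\<^sub>R (s i - u)) \<longlonglongrightarrow> D)" for F :: "real \<Rightarrow> complex" and D
  proof -
    have "(F has_vector_derivative D) (at u) \<longleftrightarrow> ((\<lambda>v. (F v - F u) /\<^sub>R (v - u)) \<longlongrightarrow> D) (at u)"
    proof -
      have "norm ((F v - F u) - (v - u) *\<^sub>R D) / norm (v - u) = norm ((F v - F u) /\<^sub>R (v - u) - D)"
        if "v \<noteq> u" for v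
      proof -
        have "(F v - F u) /\<^sub>R (v - u) - D = ((F v - F u) - (v - u) *\<^sub>R D) /\<^sub>R (v - u)"
          using that by (simp add: scaleR_diff_right)
        then show ?thesis by (simp add: divide_inverse mult.commute)
      qed
      then have "((\<lambda>v. norm ((F v - F u) - (v - u) *\<^sub>R D) / norm (v - u)) \<longlongrightarrow> 0) (at u) \<longleftrightarrow>
          ((\<lambda>v. norm ((F v - F u) /\<^sub>R (v - u) - D)) \<longlongrightarrow> 0) (at u)"
        by (intro filterlim_cong refl) (auto simp: eventually_at_filter)
      then show ?thesis
        unfolding has_vector_derivative_def has_derivative_iff_norm
        by (simp add: bounded_linear_scaleR_left tendsto_norm_zero_iff flip: LIM_zero_iff[where l=D])
    qed
    then show ?thesis by (auto simp: tendsto_at_iff_sequentially comp_def)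
  qed
  show ?thesis
    unfolding quot
  proof (intro allI impI)
    fix s :: "nat \<Rightarrow> real" assume ne: "\<forall>i. s i \<noteq> u" and lim: "s \<longlonglongrightarrow> u"
    have "(\<lambda>i. \<integral>x. (f (s i) x - f u x) /\<^sub>R (s i - u) \<partial>M) \<longlonglongrightarrow> (\<integral>x. f' x \<partial>M)"
    proof (rule integral_dominated_convergence[where w = w])
      show "AE x in M. (\<lambda>i. (f (s i) x - f u x) /\<^sub>R (s i - u)) \<longlonglongrightarrow> f' x"
        using deriv ne lim unfolding quot by auto
      show "AE x in M. norm ((f (s i) x - f u x) /\<^sub>R (s i - u)) \<le> w x" for i
      proof (rule AE_I2)
        fix x
        have "0 < \<bar>s i - u\<bar>" using ne by simp
        then show "norm ((f (s i) x - f u x) /\<^sub>R (s i - u)) \<le> w x"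
          using lip[of "s i" x] unfolding norm_scaleR by (simp add: field_simps abs_inverse)
      qed
    qed (use int f' w in \<open>auto intro!: borel_measurable_scaleR borel_measurable_diff\<close>)
    then show "(\<lambda>i. ((\<integral>x. f (s i) x \<partial>M) - (\<integral>x. f u x \<partial>M)) /\<^sub>R (s i - u)) \<longlonglongrightarrow> (\<integral>x. f' x \<partial>M)"
      by (simp add: int)
  qed
qed

lemma iexp_lipschitz: "cmod (iexp (v * x) - iexp (u * x)) \<le> \<bar>v - u\<bar> * \<bar>x\<bar>"
proof -
  have "iexp (v * x) - iexp (u * x) = iexp (u * x) * (iexp ((v - u) * x) - 1)"
    by (simp add: algebra_simps flip: exp_add)
  then have "cmod (iexp (v * x) - iexp (u * x)) = cmod (iexp ((v - u) * x) - 1)"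
    by (simp add: norm_mult)
  also have "\<dots> \<le> \<bar>v - u\<bar> * \<bar>x\<bar>"
    using iexp_approx1[of "(v - u) * x" 0] by (simp add: abs_mult)
  finally show ?thesis .
qed

lemma iexp_mult_has_vector_derivative:
  "((\<lambda>v. iexp (v * x)) has_vector_derivative \<i> * x * iexp (u * x)) (at u)"
proof -
  have "((iexp \<circ> (\<lambda>v. v * x)) has_vector_derivative x *\<^sub>R (\<i> * iexp (u * x))) (at u)"
    using has_vector_derivative_iexp[of "u * x" UNIV]
    by (intro vector_diff_chain_at)
      (auto simp: has_vector_derivative_def mult.commute[of _ x] intro!: derivative_eq_intros)
  then show ?thesis
    by (simp add: comp_def scaleR_conv_of_real mult_ac)
qed

lemma (in real_distribution) char_has_vector_derivative:
  assumes "integrable M (\<lambda>x. x)"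
  shows "(char M has_vector_derivative \<i> * (CLINT x|M. x * iexp (u * x))) (at u)"
proof -
  have "((\<lambda>v. CLINT x|M. iexp (v * x)) has_vector_derivative
      (CLINT x|M. \<i> * x * iexp (u * x))) (at u)"
  proof (rule has_vector_derivative_integral[where w = abs])
    show "complex_integrable M (\<lambda>x. iexp (v * x))" for v
      by (rule integrable_iexp) auto
  qed (use assms iexp_lipschitz iexp_mult_has_vector_derivative in auto)
  then show ?thesis
    by (simp add: char_def[abs_def] mult.assoc)
qed

section \<open>The exponent and its kernel\<close>

text \<open>
  The continuous extension of \<open>(e\<^sup>i\<^sup>u\<^sup>y - 1) / y\<close> to \<open>y = 0\<close>; it is the integral of \<open>\<i> e\<^sup>i\<^sup>v\<^sup>y\<close> over \<open>v\<close>
  from \<open>0\<close> to \<open>u\<close>.  Including the value at \<open>0\<close> merges the drift and the jump part of the exponent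
  into one integral.
\<close>

definition jump_kernel :: "real \<Rightarrow> real \<Rightarrow> complex" where
  "jump_kernel u y = (if y = 0 then \<i> * u else (iexp (u * y) - 1) / y)"

definition jump_exponent :: "real measure \<Rightarrow> real \<Rightarrow> complex" where
  "jump_exponent \<alpha> u = (CLINT y|\<alpha>. jump_kernel u y)"

lemma jump_kernel_lipschitz: "cmod (jump_kernel v y - jump_kernel u y) \<le> \<bar>v - u\<bar>"
proof (cases "y = 0")
  case True
  have "jump_kernel v y - jump_kernel u y = \<i> * of_real (v - u)"
    using True by (simp add: jump_kernel_def algebra_simps)
  then show ?thesis by (simp add: norm_mult flip: of_real_diff)
next
  case False
  then have "jump_kernel v y - jump_kernel u y = (iexp (v * y) - iexp (u * y)) / y"
    by (simp add: jump_kernel_def diff_divide_distrib)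
  then have "cmod (jump_kernel v y - jump_kernel u y) = cmod (iexp (v * y) - iexp (u * y)) / \<bar>y\<bar>"
    by (simp add: norm_divide)
  also have "\<dots> \<le> \<bar>v - u\<bar>"
    using False iexp_lipschitz[of v y u] by (simp add: divide_le_eq)
  finally show ?thesis .
qed

lemma jump_kernel_zero [simp]: "jump_kernel 0 y = 0"
  by (simp add: jump_kernel_def)

lemma jump_kernel_bound: "cmod (jump_kernel u y) \<le> \<bar>u\<bar>"
  using jump_kernel_lipschitz[of u y 0] by simp

lemma jump_kernel_has_vector_derivative:
  "((\<lambda>v. jump_kernel v y) has_vector_derivative \<i> * iexp (u * y)) (at u)"
proof (cases "y = 0")
  case True
  then show ?thesis
    by (auto simp: jump_kernel_def intro!: derivative_eq_intros)
next
  case False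
  have "((\<lambda>v. (iexp (v * y) - 1) / y) has_vector_derivative (\<i> * y * iexp (u * y) - 0) / y) (at u)"
    by (intro has_vector_derivative_divide has_vector_derivative_diff
        iexp_mult_has_vector_derivative has_vector_derivative_const)
  then show ?thesis
    using False by (simp add: jump_kernel_def)
qed

text \<open>
  Continuity at \<open>y = 0\<close> is what turns an atom of \<open>\<alpha>\<close> at \<open>0\<close> into a drift when the argument \<open>y\<close> is
  approximated by strictly positive values.
\<close>

lemma continuous_jump_kernel: "continuous_on UNIV (jump_kernel u)"
proof (clarsimp simp: continuous_on_eq_continuous_at)
  fix y :: real
  show "isCont (jump_kernel u) y"
  proof (cases "y = 0")
    case True
    have "((\<lambda>t. jump_kernel u t - jump_kernel u 0) \<longlongrightarrow> 0) (at 0)"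
    proof (rule Lim_null_comparison)
      have "cmod (jump_kernel u t - jump_kernel u 0) \<le> u\<^sup>2 * \<bar>t\<bar> / 2" if "t \<noteq> 0" for t
      proof -
        have "jump_kernel u t - jump_kernel u 0 = (iexp (u * t) - (\<Sum>k\<le>1. (\<i> * (u * t))^k / fact k)) / t"
          using that by (simp add: jump_kernel_def field_simps)
        then have "cmod (jump_kernel u t - jump_kernel u 0)
            = cmod (iexp (u * t) - (\<Sum>k\<le>1. (\<i> * (u * t))^k / fact k)) / \<bar>t\<bar>"
          by (simp add: norm_divide)
        also have "\<dots> \<le> (\<bar>u * t\<bar> ^ 2 / 2) / \<bar>t\<bar>"
          using iexp_approx1[of "u * t" 1]
          by (intro divide_right_mono) (simp_all add: fact_2 numeral_2_eq_2)
        also have "\<dots> = u\<^sup>2 * \<bar>t\<bar> / 2"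
          using that by (simp add: power_mult_distrib power2_eq_square abs_mult)
        finally show ?thesis .
      qed
      then show "\<forall>\<^sub>F t in at 0. cmod (jump_kernel u t - jump_kernel u 0) \<le> u\<^sup>2 * \<bar>t\<bar> / 2"
        by (auto simp: eventually_at_filter)
      show "((\<lambda>t. u\<^sup>2 * \<bar>t\<bar> / 2) \<longlongrightarrow> 0) (at 0)"
        by (auto intro!: tendsto_eq_intros)
    qed
    then show ?thesis
      using True by (simp add: isCont_def LIM_zero_iff)
  next
    case False
    have "isCont (\<lambda>t. (iexp (u * t) - 1) / complex_of_real t) y"
      using False by (intro continuous_intros) auto
    moreover have "\<forall>\<^sub>F t in nhds y. jump_kernel u t = (iexp (u * t) - 1) / complex_of_real t"
      using t1_space_nhds[OF False] by eventually_elim (simp add: jump_kernel_def)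
    ultimately show ?thesis
      by (simp add: isCont_cong)
  qed
qed

lemma measurable_jump_kernel [measurable]: "jump_kernel u \<in> borel_measurable borel"
  by (rule borel_measurable_continuous_onI[OF continuous_jump_kernel])

lemma (in real_distribution) integrable_jump_kernel:
  "f \<in> borel_measurable borel \<Longrightarrow> complex_integrable M (\<lambda>y. jump_kernel u (f y))"
  by (rule integrable_const_bound[where B = "\<bar>u\<bar>"]) (auto simp: jump_kernel_bound)

text \<open>
  Dividing by \<open>y\<close> in the kernel cancels the factor \<open>y\<close> produced by differentiating \<open>e\<^sup>i\<^sup>u\<^sup>y\<close>, so
  the kernels are Lipschitz in \<open>u\<close> with constant \<open>1\<close>, uniformly in \<open>y\<close>.
\<close>

lemma (in real_distribution) jump_exponent_has_vector_derivative:
  "(jump_exponent M has_vector_derivative \<i> * char M u) (at u)"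
proof -
  have "((\<lambda>v. CLINT y|M. jump_kernel v y) has_vector_derivative (CLINT y|M. \<i> * iexp (u * y))) (at u)"
    using integrable_jump_kernel[of id] jump_kernel_has_vector_derivative jump_kernel_lipschitz
    by (intro has_vector_derivative_integral[where w = "\<lambda>_. 1"]) auto
  then show ?thesis
    by (simp add: jump_exponent_def[abs_def] char_def)
qed

section \<open>Size biasing as a differential equation\<close>

text \<open>
  The mean is a parameter because the roots of an infinitely divisible law of mean \<open>a\<close> have the
  means \<open>a / n\<close>.
\<close>

locale nonneg_mean_law = real_distribution \<mu> for \<mu> :: "real measure" +
  fixes a :: real
  assumes nonneg: "AE x in \<mu>. 0 \<le> x"
    and integrable_id: "integrable \<mu> (\<lambda>x. x)"
    and mean: "(\<integral>x. x \<partial>\<mu>) = a"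
    and mean_pos: "0 < a"
begin

lemma size_biased_eq: "size_biased \<mu> = density \<mu> (\<lambda>x. ennreal (x / a))"
  by (simp add: size_biased_def mean)

lemma real_distribution_size_biased: "real_distribution (size_biased \<mu>)"
proof -
  have "emeasure (size_biased \<mu>) (space (size_biased \<mu>)) = (\<integral>\<^sup>+ x. ennreal (x / a) \<partial>\<mu>)"
    by (simp add: size_biased_eq emeasure_density)
  also have "\<dots> = ennreal (\<integral>x. x / a \<partial>\<mu>)"
    using nonneg mean_pos by (intro nn_integral_eq_integral) (auto simp: integrable_id)
  also have "\<dots> = 1"
    using mean mean_pos by simp
  finally have "prob_space (size_biased \<mu>)"
    by (rule prob_spaceI)
  then show ?thesis
    by (simp add: real_distribution_def real_distribution_axioms_def size_biased_eq)
qed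

lemma integral_size_biased:
  fixes f :: "real \<Rightarrow> 'b :: {banach, second_countable_topology}"
  assumes "f \<in> borel_measurable borel"
  shows "(\<integral>x. f x \<partial>size_biased \<mu>) = (\<integral>x. x *\<^sub>R f x \<partial>\<mu>) /\<^sub>R a"
proof -
  have "(\<integral>x. f x \<partial>size_biased \<mu>) = (\<integral>x. (x / a) *\<^sub>R f x \<partial>\<mu>)"
    unfolding size_biased_eq using assms nonneg mean_pos by (intro integral_density) auto
  also have "\<dots> = (\<integral>x. inverse a *\<^sub>R (x *\<^sub>R f x) \<partial>\<mu>)"
    by (simp add: divide_inverse mult.commute)
  finally show ?thesis
    by (simp only: integral_scaleR_right)
qed

text \<open>
  Differentiating \<open>E e\<^sup>i\<^sup>u\<^sup>X\<close> produces the weight \<open>X\<close>, which is \<open>a\<close> times the density of the size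
  biased law.
\<close>

lemma char_derivative_size_biased:
  "(char \<mu> has_vector_derivative \<i> * a * char (size_biased \<mu>) u) (at u)"
  using char_has_vector_derivative[OF integrable_id, of u] mean_pos
  by (simp add: char_def integral_size_biased scaleR_conv_of_real field_simps)

lemma AE_size_biased:
  assumes "AE x in \<mu>. P x"
  shows "AE x in size_biased \<mu>. P x"
  unfolding size_biased_eq using assms by (subst AE_density) auto

text \<open>
  The factorization says \<open>\<phi>' = \<i> a \<psi> \<phi>\<close>, where \<open>\<phi>\<close> and \<open>\<psi>\<close> are the characteristic functions of
  \<open>\<mu>\<close> and \<open>\<alpha>\<close>.  The exponent is an antiderivative of \<open>\<i> \<psi>\<close>, and \<open>\<phi> 0 = 1\<close>.
\<close>

lemma char_eq_exp_jump_exponent: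
  assumes \<alpha>: "real_distribution \<alpha>"
    and factor: "\<And>u. char (size_biased \<mu>) u = char \<mu> u * char \<alpha> u"
  shows "char \<mu> u = exp (a * jump_exponent \<alpha> u)"
proof -
  interpret \<alpha>: real_distribution \<alpha> by fact
  define G where "G u = char \<mu> u * exp (- a * jump_exponent \<alpha> u)" for u
  have "(G has_vector_derivative 0) (at u)" for u
  proof -
    have "((\<lambda>u. - a * jump_exponent \<alpha> u) has_vector_derivative - a * (\<i> * char \<alpha> u)) (at u)"
      by (intro has_vector_derivative_mult_right \<alpha>.jump_exponent_has_vector_derivative)
    from field_vector_diff_chain_at[OF this DERIV_exp]
    have "((\<lambda>u. exp (- a * jump_exponent \<alpha> u)) has_vector_derivative
        - a * (\<i> * char \<alpha> u) * exp (- a * jump_exponent \<alpha> u)) (at u)"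
      by (simp add: comp_def)
    from has_vector_derivative_mult[OF char_derivative_size_biased this]
    show ?thesis
      by (simp add: G_def[abs_def] factor algebra_simps)
  qed
  then obtain c where c: "\<And>u. G u = c"
    using has_vector_derivative_zero_constant[of UNIV G] by auto
  have "G 0 = 1"
    by (simp add: G_def char_zero jump_exponent_def)
  then have "G u = 1" using c by metis
  then have "char \<mu> u * exp (- a * jump_exponent \<alpha> u) * exp (a * jump_exponent \<alpha> u) = exp (a * jump_exponent \<alpha> u)"
    by (simp add: G_def)
  then show ?thesis
    by (simp add: mult.assoc flip: exp_add)
qed

text \<open>
  Being an exponential, \<open>char \<mu>\<close> has no zeros and can be cancelled.
\<close>

lemma size_bias_factor_unique:
  assumes "real_distribution \<alpha>" "real_distribution \<beta>"
    and "\<And>u. char (size_biased \<mu>) u = char \<mu> u * char \<alpha> u"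
    and "\<And>u. char (size_biased \<mu>) u = char \<mu> u * char \<beta> u"
  shows "\<alpha> = \<beta>"
proof (rule Levy_uniqueness[OF assms(1,2)], rule ext)
  fix u
  have "char \<mu> u \<noteq> 0"
    using char_eq_exp_jump_exponent[OF assms(1,3)] by simp
  then show "char \<alpha> u = char \<beta> u"
    using assms(3,4)[of u] by simp
qed

end

section \<open>Independent decompositions\<close>

lemma size_bias_decomposition_char:
  assumes "size_bias_decomposition \<mu> N X Y"
  shows "real_distribution (distr N borel Y)"
    and "char (size_biased \<mu>) u = char \<mu> u * char (distr N borel Y) u"
proof -
  interpret prob_space N
    using assms by (simp add: size_bias_decomposition_def)
  have ind: "indep_var borel X borel Y"
    using assms by (simp add: size_bias_decomposition_def)
  show "real_distribution (distr N borel Y)"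
    using indep_var_rv2[OF ind] by simp
  show "char (size_biased \<mu>) u = char \<mu> u * char (distr N borel Y) u"
    using char_distr_add[OF ind] assms by (simp add: size_bias_decomposition_def)
qed

text \<open>
  Suppose \<open>Y < - e\<close> had positive probability, and let \<open>c\<close> be an almost sure lower bound of \<open>X\<close>.
  Size biasing is absolutely continuous, so \<open>c\<close> bounds \<open>X + Y\<close> as well, and by independence \<open>X < c + e\<close>
  together with \<open>Y < - e\<close> is a null event only if \<open>c + e\<close> is also a lower bound of \<open>X\<close>.  Starting from
  \<open>c = 0\<close> the lower bounds grow without limit.
\<close>

lemma (in nonneg_mean_law) size_bias_decomposition_nonneg:
  assumes decomp: "size_bias_decomposition \<mu> N X Y"
  shows "AE \<omega> in N. 0 \<le> Y \<omega>"
proof -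
  interpret N: prob_space N
    using decomp by (simp add: size_bias_decomposition_def)
  have ind: "N.indep_var borel X borel Y"
    and \<mu>_eq: "distr N borel X = \<mu>"
    and sb_eq: "size_biased \<mu> = distr N borel (\<lambda>\<omega>. X \<omega> + Y \<omega>)"
    using decomp by (simp_all add: size_bias_decomposition_def)
  note [measurable] = N.indep_var_rv1[OF ind] N.indep_var_rv2[OF ind]
  have nonneg_up_to: "AE \<omega> in N. - e \<le> Y \<omega>" if "0 < e" for e :: real
  proof (rule ccontr)
    assume neg: "\<not> (AE \<omega> in N. - e \<le> Y \<omega>)"
    have step: "AE x in \<mu>. c + e \<le> x" if "AE x in \<mu>. c \<le> x" for c
    proof -
      have "AE \<omega> in N. c \<le> X \<omega> + Y \<omega>"
        using AE_size_biased[OF that] unfolding sb_eq by (simp add: AE_distr_iff)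
      then have "AE \<omega> in N. \<not> (X \<omega> < c + e \<and> Y \<omega> < - e)"
        by eventually_elim auto
      then have "0 = N.prob ((\<lambda>\<omega>. (X \<omega>, Y \<omega>)) -` ({..<c + e} \<times> {..<-e}) \<inter> space N)"
        by (subst (asm) AE_iff_measurable[OF _ refl]) 
          (auto simp: measure_def vimage_def Int_def conj_commute)
      also have "\<dots> = N.prob (X -` {..<c + e} \<inter> space N) * N.prob (Y -` {..<-e} \<inter> space N)"
        by (rule N.indep_varD[OF ind]) auto
      finally have "N.prob (X -` {..<c + e} \<inter> space N) = 0 \<or> N.prob (Y -` {..<-e} \<inter> space N) = 0"
        by simp
      moreover have "N.prob (Y -` {..<-e} \<inter> space N) \<noteq> 0"
        using neg by (subst (asm) AE_iff_measurable[OF _ refl])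
          (auto simp: N.emeasure_eq_measure vimage_def Int_def conj_commute not_le)
      ultimately have "AE \<omega> in N. c + e \<le> X \<omega>"
        by (subst AE_iff_measurable[OF _ refl])
          (auto simp: N.emeasure_eq_measure vimage_def Int_def conj_commute not_le)
      then show ?thesis
        unfolding \<mu>_eq[symmetric] by (simp add: AE_distr_iff)
    qed
    have "AE x in \<mu>. real n * e \<le> x" for n
    proof (induction n)
      case 0
      then show ?case using nonneg by simp
    next
      case (Suc n)
      then show ?case using step[OF Suc] by (simp add: algebra_simps)
    qed
    then have "AE x in \<mu>. \<forall>n. real n * e \<le> x"
      by (simp add: AE_all_countable)
    then have "AE x in \<mu>. False"
    proof eventually_elim
      case (elim x)
      then show False using reals_Archimedean3[OF \<open>0 < e\<close>] by (metis not_le)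
    qed
    then show False by simp
  qed
  have "AE \<omega> in N. \<forall>n. - inverse (real (Suc n)) \<le> Y \<omega>"
    unfolding AE_all_countable by (intro allI nonneg_up_to) simp
  then show ?thesis
  proof eventually_elim
    case (elim \<omega>)
    show ?case
    proof (rule ccontr)
      assume "\<not> 0 \<le> Y \<omega>"
      then obtain n where "inverse (real (Suc n)) < - Y \<omega>"
        using reals_Archimedean[of "- Y \<omega>"] by auto
      then show False using elim by (smt (verit))
    qed
  qed
qed

lemma (in real_distribution) jump_exponent_nonneg:
  assumes "AE y in M. 0 \<le> y"
  shows "jump_exponent M u = \<i> * u * measure M {0} + (CLINT y:{0<..}|M. (iexp (u * y) - 1) / y)"
proof -
  have "jump_exponent M u = (CLINT y|M. indicator {0} y *\<^sub>R (\<i> * u) + indicator {0<..} y *\<^sub>R jump_kernel u y)"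
    unfolding jump_exponent_def using assms
    by (intro integral_cong_AE) (auto elim!: eventually_mono simp: jump_kernel_def indicator_def)
  also have "\<dots> = (CLINT y|M. indicator {0} y *\<^sub>R (\<i> * u)) + (CLINT y|M. indicator {0<..} y *\<^sub>R jump_kernel u y)"
    using integrable_jump_kernel[of id]
    by (intro Bochner_Integration.integral_add integrable_mult_indicator) auto
  also have "(CLINT y|M. indicator {0} y *\<^sub>R (\<i> * u)) = \<i> * u * measure M {0}"
    by (simp add: scaleR_conv_of_real)
  also have "(CLINT y|M. indicator {0<..} y *\<^sub>R jump_kernel u y) = (CLINT y:{0<..}|M. (iexp (u * y) - 1) / y)"
    unfolding set_lebesgue_integral_def
    by (intro Bochner_Integration.integral_cong) (auto simp: jump_kernel_def indicator_def)
  finally show ?thesis .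
qed

section \<open>Laws with a prescribed exponent\<close>

lemma (in real_distribution) iid_coordinates:
  fixes n :: nat
  assumes n: "0 < n"
  defines "P \<equiv> \<Pi>\<^sub>M i\<in>{..<n}. M"
  shows "prob_space P"
    and "i < n \<Longrightarrow> distr P borel (\<lambda>\<omega>. \<omega> i) = M"
    and "prob_space.indep_vars P (\<lambda>_. borel) (\<lambda>i \<omega>. \<omega> i) {..<n}"
    and "char (distr P borel (\<lambda>\<omega>. \<Sum>i<n. \<omega> i)) t = char M t ^ n"
proof -
  show P: "prob_space P"
    unfolding P_def by (intro prob_space_PiM prob_space_axioms)
  then interpret P: prob_space P .
  have rv: "(\<lambda>\<omega>. \<omega> i) \<in> borel_measurable P" if "i < n" for i
    using measurable_component_singleton[of i "{..<n}" "\<lambda>_. M"] that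
    by (simp add: P_def cong: measurable_cong_sets)
  have comp: "distr P borel (\<lambda>\<omega>. \<omega> i) = M" if "i < n" for i
  proof -
    have "distr P borel (\<lambda>\<omega>. \<omega> i) = distr P M (\<lambda>\<omega>. \<omega> i)"
      by (intro distr_cong) auto
    also have "\<dots> = M"
      unfolding P_def using that by (intro distr_PiM_component prob_space_axioms) auto
    finally show ?thesis .
  qed
  then show "i < n \<Longrightarrow> distr P borel (\<lambda>\<omega>. \<omega> i) = M" .
  show ind: "P.indep_vars (\<lambda>_. borel) (\<lambda>i \<omega>. \<omega> i) {..<n}"
  proof (subst P.indep_vars_iff_distr_eq_PiM')
    have "distr P (\<Pi>\<^sub>M i\<in>{..<n}. borel) (\<lambda>x. \<lambda>i\<in>{..<n}. x i) = distr P P (\<lambda>x. x)"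
    proof (intro distr_cong refl)
      show "sets (\<Pi>\<^sub>M i\<in>{..<n}. borel) = sets P"
        unfolding P_def by (intro sets_PiM_cong) auto
      show "(\<lambda>i\<in>{..<n}. x i) = x" if "x \<in> space P" for x
        using that by (auto simp: P_def space_PiM PiE_def extensional_restrict)
    qed
    also have "\<dots> = (\<Pi>\<^sub>M i\<in>{..<n}. distr P borel (\<lambda>\<omega>. \<omega> i))"
    proof -
      have "(\<Pi>\<^sub>M i\<in>{..<n}. distr P borel (\<lambda>\<omega>. \<omega> i)) = P"
        unfolding P_def using comp[unfolded P_def] by (intro PiM_cong) auto
      then show ?thesis by simp
    qed
    finally show "distr P (\<Pi>\<^sub>M i\<in>{..<n}. borel) (\<lambda>x. \<lambda>i\<in>{..<n}. x i) =
        (\<Pi>\<^sub>M i\<in>{..<n}. distr P borel (\<lambda>\<omega>. \<omega> i))" .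
  qed (use n rv in auto)
  show "char (distr P borel (\<lambda>\<omega>. \<Sum>i<n. \<omega> i)) t = char M t ^ n"
    using P.char_distr_sum[OF ind] by (simp add: comp)
qed

text \<open>
  Tightness asks for mass on half-open intervals, hence the left end point \<open>-1\<close> below the atom that
  the laws may have at \<open>0\<close>.
\<close>

lemma tight_nonneg:
  fixes M :: "nat \<Rightarrow> real measure"
  assumes dist: "\<And>n. real_distribution (M n)"
    and nonneg: "\<And>n. AE x in M n. 0 \<le> x"
    and tail: "\<And>e. 0 < e \<Longrightarrow> \<exists>b. \<forall>n. measure (M n) {b<..} < e"
  shows "tight M"
  unfolding tight_def
proof (intro conjI allI impI dist)
  fix e :: real assume "0 < e"
  then obtain b where b: "\<And>n. measure (M n) {b<..} < e"
    using tail by blast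
  have "1 - e < measure (M n) {-1<..max 0 b}" for n
  proof -
    interpret real_distribution "M n" by (rule dist)
    have "1 = measure (M n) ({-1<..max 0 b} \<union> {max 0 b<..})"
      using nonneg[of n] by (intro prob_eq_1[THEN iffD2, symmetric]) (auto elim!: eventually_mono)
    also have "\<dots> \<le> measure (M n) {-1<..max 0 b} + measure (M n) {max 0 b<..}"
      by (rule measure_Un_le) auto
    also have "measure (M n) {max 0 b<..} \<le> measure (M n) {b<..}"
      by (rule finite_measure_mono) auto
    also have "\<dots> < e" by (rule b)
    finally show ?thesis by simp
  qed
  then show "\<exists>a b. a < b \<and> (\<forall>n. 1 - e < measure (M n) {a<..b})"
    by (intro exI[of _ "-1"] exI[of _ "max 0 b"]) auto
qed

text \<open>
  The law of a variable that takes the value \<open>z Y\<close> with conditional probability \<open>p Y\<close> and is \<open>0\<close>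
  otherwise, where \<open>Y\<close> has law \<open>\<alpha>\<close>.  The constant product \<open>p y * z y = d\<close> fixes the
  conditional mean at \<open>d\<close>.  Sums of such variables approximate compound Poisson variables.
\<close>

lemma thinned_law_exists:
  fixes \<alpha> :: "real measure" and z p :: "real \<Rightarrow> real"
  assumes "real_distribution \<alpha>"
    and [measurable]: "z \<in> borel_measurable borel" "p \<in> borel_measurable borel"
    and p: "\<And>y. 0 \<le> p y" "\<And>y. p y \<le> 1"
    and z: "\<And>y. 0 \<le> z y" and pz: "\<And>y. p y * z y = d"
  obtains \<nu> where "real_distribution \<nu>" "AE x in \<nu>. 0 \<le> x"
    "integrable \<nu> (\<lambda>x. x)" "(\<integral>x. x \<partial>\<nu>) = d"
    "\<And>u. char \<nu> u = 1 + (CLINT y|\<alpha>. p y * (iexp (u * z y) - 1))"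
proof -
  interpret \<alpha>: real_distribution \<alpha> by fact
  \<comment> \<open>an independent uniform variable decides whether the value \<open>z Y\<close> is kept\<close>
  define U :: "real measure" where "U = uniform_measure lborel {0..<1}"
  have U: "prob_space U"
    unfolding U_def by (rule prob_space_uniform_measure) auto
  interpret U: prob_space U by (rule U)
  interpret P: pair_prob_space \<alpha> U ..
  define f where "f = (\<lambda>(y, v). if v < p y then z y else 0)"
  have setsU [measurable_cong]: "sets U = sets borel" by (simp add: U_def)
  have f_meas [measurable]: "f \<in> borel_measurable (\<alpha> \<Otimes>\<^sub>M U)"
    unfolding f_def by measurable
  have U_sets [simp]: "{v. v < p y} \<in> sets U" for y
    by (simp add: setsU)
  have U_space [simp]: "space U = UNIV"
    by (simp add: U_def)
  have prob_U: "measure U {v. v < p y} = p y" for y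
  proof -
    have "{0..<1} \<inter> {v. v < p y} = {0..<p y}" using p(2)[of y] by auto
    then show ?thesis
      using p(1)[of y] by (simp add: U_def measure_uniform_measure)
  qed
  have fibre_integral: "has_bochner_integral U (\<lambda>v. g (f (y, v))) (g 0 + p y *\<^sub>R (g (z y) - g 0))"
    for g :: "real \<Rightarrow> 'c :: {banach, second_countable_topology}" and y
  proof -
    have "has_bochner_integral U (\<lambda>v. indicator {v. v < p y} v *\<^sub>R (g (z y) - g 0))
        (p y *\<^sub>R (g (z y) - g 0))"
      using has_bochner_integral_indicator[OF U_sets, of y "g (z y) - g 0"]
      by (simp add: prob_U U.emeasure_eq_measure)
    moreover have "has_bochner_integral U (\<lambda>v. g 0) (g 0)"
      using U.prob_space by (simp add: has_bochner_integral_iff)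
    ultimately have "has_bochner_integral U
        (\<lambda>v. g 0 + indicator {v. v < p y} v *\<^sub>R (g (z y) - g 0)) (g 0 + p y *\<^sub>R (g (z y) - g 0))"
      by (intro has_bochner_integral_add)
    also have "(\<lambda>v. g 0 + indicator {v. v < p y} v *\<^sub>R (g (z y) - g 0)) = (\<lambda>v. g (f (y, v)))"
      by (auto simp: f_def indicator_def)
    finally show ?thesis .
  qed
  note fibre = fibre_integral[THEN has_bochner_integral_integral_eq]
  note fib_int = fibre_integral[THEN integrable.intros]
  define \<nu> where "\<nu> = distr (\<alpha> \<Otimes>\<^sub>M U) borel f"
  show thesis
  proof (rule that[of \<nu>])
    show "real_distribution \<nu>"
      unfolding \<nu>_def by (rule P.real_distribution_distr) simp
    show "AE x in \<nu>. 0 \<le> x"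
      unfolding \<nu>_def by (subst AE_distr_iff) (auto simp: f_def z)
    have f_nonneg: "0 \<le> f x" for x by (cases x) (simp add: f_def z)
    have f_int: "integrable (\<alpha> \<Otimes>\<^sub>M U) f"
    proof (rule P.Fubini_integrable)
      show "integrable \<alpha> (\<lambda>y. \<integral>v. norm (f (y, v)) \<partial>U)"
        using f_nonneg fibre[of "\<lambda>x. x"] by (simp add: pz)
      show "AE y in \<alpha>. integrable U (\<lambda>v. f (y, v))"
        using fib_int[of "\<lambda>x. x"] by simp
    qed simp
    show "integrable \<nu> (\<lambda>x. x)"
      using f_int unfolding \<nu>_def by (simp add: integrable_distr_eq)
    have "(\<integral>x. x \<partial>\<nu>) = (\<integral>y. \<integral>v. f (y, v) \<partial>U \<partial>\<alpha>)"
      unfolding \<nu>_def by (subst P.integral_fst'[OF f_int]) (simp add: integral_distr)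
    also have "\<dots> = d"
      using fibre[of "\<lambda>x. x"] \<alpha>.prob_space by (simp add: pz)
    finally show "(\<integral>x. x \<partial>\<nu>) = d" .
    fix u
    have int_e: "complex_integrable (\<alpha> \<Otimes>\<^sub>M U) (\<lambda>x. iexp (u * f x))"
      by (rule P.integrable_iexp) auto
    have "char \<nu> u = (CLINT y|\<alpha>. CLINT v|U. iexp (u * f (y, v)))"
      unfolding \<nu>_def char_def by (subst P.integral_fst'[OF int_e]) (simp add: integral_distr)
    also have "\<dots> = (CLINT y|\<alpha>. 1 + p y * (iexp (u * z y) - 1))"
      using fibre[of "\<lambda>x. iexp (u * x)"] by (simp add: scaleR_conv_of_real)
    also have "\<dots> = 1 + (CLINT y|\<alpha>. p y * (iexp (u * z y) - 1))"
    proof (subst Bochner_Integration.integral_add)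
      show "complex_integrable \<alpha> (\<lambda>y. p y * (iexp (u * z y) - 1))"
      proof (rule \<alpha>.integrable_const_bound[where B = 2], rule AE_I2)
        fix y
        have "cmod (p y * (iexp (u * z y) - 1)) \<le> 1 * (cmod (iexp (u * z y)) + cmod 1)"
          unfolding norm_mult using p[of y] by (intro mult_mono norm_triangle_ineq4) auto
        then show "cmod (p y * (iexp (u * z y) - 1)) \<le> 2" by simp
      qed simp
    qed (use \<alpha>.prob_space in auto)
    finally show "char \<nu> u = 1 + (CLINT y|\<alpha>. p y * (iexp (u * z y) - 1))" .
  qed
qed

text \<open>
  Since \<open>Ln\<close> has derivative \<open>1\<close> at \<open>1\<close>, \<open>k Ln (1 + h)\<close> is asymptotically \<open>k h\<close>.
\<close>

lemma tendsto_one_plus_power_exp: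
  fixes h :: "nat \<Rightarrow> complex"
  assumes h: "(\<lambda>n. of_nat (k n) * h n) \<longlonglongrightarrow> w" and h0: "h \<longlonglongrightarrow> 0"
  shows "(\<lambda>n. (1 + h n) ^ k n) \<longlonglongrightarrow> exp w"
proof -
  \<comment> \<open>\<open>h n = 0\<close> may occur, so the quotient gets its limit as value at \<open>0\<close>\<close>
  define g :: "complex \<Rightarrow> complex" where "g z = (if z = 0 then 1 else Ln (1 + z) / z)" for z
  have "(Ln has_field_derivative inverse 1) (at 1)"
    by (rule has_field_derivative_Ln) auto
  then have "((\<lambda>z. Ln (1 + z) / z) \<longlongrightarrow> g 0) (at 0)"
    by (simp add: DERIV_def g_def)
  then have "(g \<longlongrightarrow> g 0) (at 0)"
    by (rule Lim_transform_eventually) (simp add: g_def eventually_at_filter)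
  then have "(\<lambda>n. g (h n)) \<longlonglongrightarrow> g 0"
    by (intro isCont_tendsto_compose[OF _ h0]) (simp add: isCont_def)
  then have "(\<lambda>n. (of_nat (k n) * h n) * g (h n)) \<longlonglongrightarrow> w * g 0"
    by (intro tendsto_mult h)
  then have "(\<lambda>n. exp (of_nat (k n) * h n * g (h n))) \<longlonglongrightarrow> exp w"
    by (intro tendsto_exp) (simp add: g_def)
  moreover have "\<forall>\<^sub>F n in sequentially. h n \<noteq> -1"
    using h0 by (intro tendsto_imp_eventually_ne) auto
  then have "\<forall>\<^sub>F n in sequentially. exp (of_nat (k n) * h n * g (h n)) = (1 + h n) ^ k n"
  proof eventually_elim
    case (elim n)
    then have "1 + h n \<noteq> 0" by (metis add_eq_0_iff)
    then show ?case
      by (cases "h n = 0") (simp_all add: g_def exp_of_nat_mult mult.assoc)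
  qed
  ultimately show ?thesis
    by (rule Lim_transform_eventually)
qed

text \<open>
  Let \<open>d = c / n\<close> and \<open>z = max y d\<close>.  The variable equal to \<open>z\<close> with probability \<open>d / z\<close> and to \<open>0\<close>
  otherwise, with \<open>y\<close> distributed by \<open>\<alpha>\<close>, has mean \<open>d\<close>, and its characteristic function is \<open>1\<close> plus
  \<open>d\<close> times the integral of the kernel at \<open>z\<close>.  Taking \<open>n\<close> independent copies, the sums have mean \<open>c\<close>
  for every \<open>n\<close> and are therefore tight, while their characteristic functions converge to the
  exponential.  Truncating at \<open>d\<close> keeps \<open>d / z\<close> a probability and replaces an atom of \<open>\<alpha>\<close> at \<open>0\<close> by
  small jumps.
\<close>

lemma exp_jump_exponent_is_char:
  fixes c :: real
  assumes \<alpha>: "real_distribution \<alpha>" and nonneg: "AE y in \<alpha>. 0 \<le> y" and c: "0 < c"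
  shows "\<exists>\<nu>. real_distribution \<nu> \<and> (\<forall>u. char \<nu> u = exp (c * jump_exponent \<alpha> u))"
proof -
  interpret \<alpha>: real_distribution \<alpha> by fact
  note sum.lessThan_Suc [simp del] of_nat_Suc [simp del]
  define d where "d n = c / real (Suc n)" for n
  have d_pos: "0 < d n" for n using c by (simp add: d_def)
  have d_lim: "d \<longlonglongrightarrow> 0"
    unfolding d_def using LIMSEQ_Suc[OF lim_const_over_n[of c]] by simp
  define z where "z n y = max y (d n)" for n and y :: real
  have z_ge: "d n \<le> z n y" for n y by (simp add: z_def)
  have z_pos: "0 < z n y" for n y using d_pos[of n] by (simp add: z_def)
  have z_meas [measurable]: "z n \<in> borel_measurable borel" for n
    unfolding z_def by measurable
  have "\<exists>\<nu>. real_distribution \<nu> \<and> (AE x in \<nu>. 0 \<le> x) \<and> integrable \<nu> (\<lambda>x. x) \<and> (\<integral>x. x \<partial>\<nu>) = d n \<and>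
      (\<forall>u. char \<nu> u = 1 + (CLINT y|\<alpha>. (d n / z n y) * (iexp (u * z n y) - 1)))" for n
    using z_pos[of n] z_ge[of n] d_pos[of n]
    by (rule_tac thinned_law_exists[OF \<alpha>, where z = "z n" and p = "\<lambda>y. d n / z n y" and d = "d n"])
      (auto simp: less_imp_le divide_le_eq less_imp_neq[symmetric])
  then obtain \<nu> where \<nu>: "\<And>n. real_distribution (\<nu> n)" "\<And>n. AE x in \<nu> n. 0 \<le> x"
      "\<And>n. integrable (\<nu> n) (\<lambda>x. x)" "\<And>n. (\<integral>x. x \<partial>\<nu> n) = d n"
    and char_\<nu>: "\<And>n u. char (\<nu> n) u = 1 + (CLINT y|\<alpha>. (d n / z n y) * (iexp (u * z n y) - 1))"
    by metis
  define P where "P n = (\<Pi>\<^sub>M i\<in>{..<Suc n}. \<nu> n)" for n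
  define S where "S n = distr (P n) borel (\<lambda>\<omega>. \<Sum>i<Suc n. \<omega> i)" for n
  have iid: "prob_space (P n)"
    "\<And>i. i < Suc n \<Longrightarrow> distr (P n) borel (\<lambda>\<omega>. \<omega> i) = \<nu> n"
    "prob_space.indep_vars (P n) (\<lambda>_. borel) (\<lambda>i \<omega>. \<omega> i) {..<Suc n}"
    "\<And>t. char (distr (P n) borel (\<lambda>\<omega>. \<Sum>i<Suc n. \<omega> i)) t = char (\<nu> n) t ^ Suc n" for n
    unfolding P_def by (fact real_distribution.iid_coordinates[OF \<nu>(1) zero_less_Suc])+
  have coord_meas: "(\<lambda>\<omega>. \<omega> i) \<in> borel_measurable (P n)" if "i < Suc n" for i n
    using iid(3)[of n] that unfolding prob_space.indep_vars_def2[OF iid(1)] by auto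
  have sum_meas [measurable]: "(\<lambda>\<omega>. \<Sum>i<Suc n. \<omega> i) \<in> borel_measurable (P n)" for n
    by (intro borel_measurable_sum coord_meas) auto
  have S_dist: "real_distribution (S n)" for n
    unfolding S_def by (intro prob_space.real_distribution_distr iid(1) sum_meas)
  have sum_nonneg: "AE \<omega> in P n. 0 \<le> (\<Sum>i<Suc n. \<omega> i)" for n
  proof -
    have "AE \<omega> in P n. 0 \<le> \<omega> i" if "i < Suc n" for i
      using \<nu>(2)[of n] coord_meas[OF that]
      by (subst (asm) iid(2)[OF that, symmetric], subst (asm) AE_distr_iff) auto
    then have "AE \<omega> in P n. \<forall>i\<in>{..<Suc n}. 0 \<le> \<omega> i"
      by (subst AE_finite_all) auto
    then show ?thesis
      by eventually_elim (rule sum_nonneg, blast)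
  qed
  have coord_int: "integrable (P n) (\<lambda>\<omega>. \<omega> i)" "(\<integral>\<omega>. \<omega> i \<partial>P n) = d n" if "i < Suc n" for i n
  proof -
    have "integrable (distr (P n) borel (\<lambda>\<omega>. \<omega> i)) (\<lambda>x. x)"
      unfolding iid(2)[OF that] by (rule \<nu>(3))
    then show "integrable (P n) (\<lambda>\<omega>. \<omega> i)"
      by (subst (asm) integrable_distr_eq[OF coord_meas[OF that]]) simp_all
    have "(\<integral>\<omega>. \<omega> i \<partial>P n) = (\<integral>x. x \<partial>distr (P n) borel (\<lambda>\<omega>. \<omega> i))"
      by (rule integral_distr[OF coord_meas[OF that], symmetric]) simp
    then show "(\<integral>\<omega>. \<omega> i \<partial>P n) = d n"
      unfolding iid(2)[OF that] \<nu>(4) .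
  qed
  have sum_int: "integrable (P n) (\<lambda>\<omega>. \<Sum>i<Suc n. \<omega> i)" for n
    using coord_int by (intro Bochner_Integration.integrable_sum) auto
  have sum_mean: "(\<integral>\<omega>. (\<Sum>i<Suc n. \<omega> i) \<partial>P n) = c" for n
    using coord_int[of _ n] by (subst Bochner_Integration.integral_sum) (auto simp: d_def)
  have "tight S"
  proof (rule tight_nonneg[OF S_dist])
    show "AE x in S n. 0 \<le> x" for n
      unfolding S_def using sum_nonneg[of n] by (subst AE_distr_iff) auto
    fix e :: real assume e: "0 < e"
    \<comment> \<open>Markov's inequality, with room to spare for a strict bound\<close>
    have "measure (S n) {2 * c / e<..} < e" for n
    proof -
      interpret P: prob_space "P n" by (rule iid(1))
      have pos: "0 < 2 * c / e" using c e by simp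
      have "measure (S n) {2 * c / e<..} = measure (P n) {\<omega> \<in> space (P n). 2 * c / e < (\<Sum>i<Suc n. \<omega> i)}"
        unfolding S_def by (subst measure_distr) (auto simp: vimage_def Int_def conj_commute)
      also have "\<dots> \<le> measure (P n) {\<omega> \<in> space (P n). 2 * c / e \<le> (\<Sum>i<Suc n. \<omega> i)}"
        by (rule P.finite_measure_mono) (auto intro!: borel_measurable_le)
      also have "\<dots> \<le> c / (2 * c / e)"
        using integral_Markov_inequality_measure[OF sum_int sets.top sum_nonneg pos, of n]
        unfolding sum_mean .
      also have "\<dots> = e / 2" using c by simp
      finally show ?thesis using e by simp
    qed
    then show "\<exists>b. \<forall>n. measure (S n) {b<..} < e" by blast
  qed
  then obtain r M where r: "strict_mono r" and M: "real_distribution M"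
    and weak: "weak_conv_m (S \<circ> r) M"
    using tight_imp_convergent_subsubsequence[of S id] by (auto simp: strict_mono_id)
  have S_lim: "(\<lambda>n. char (S n) u) \<longlonglongrightarrow> exp (c * jump_exponent \<alpha> u)" for u
  proof -
    define h where "h n = char (\<nu> n) u - 1" for n
    have h_eq: "h n = d n * (CLINT y|\<alpha>. jump_kernel u (z n y))" for n
    proof -
      have "h n = (CLINT y|\<alpha>. d n * jump_kernel u (z n y))"
        unfolding h_def char_\<nu> using z_pos[of n]
        by (simp add: jump_kernel_def less_imp_neq[symmetric])
      then show ?thesis by simp
    qed
    have K: "(\<lambda>n. CLINT y|\<alpha>. jump_kernel u (z n y)) \<longlonglongrightarrow> jump_exponent \<alpha> u"
      unfolding jump_exponent_def
    proof (rule integral_dominated_convergence[where w = "\<lambda>_. \<bar>u\<bar>"])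
      show "AE y in \<alpha>. (\<lambda>n. jump_kernel u (z n y)) \<longlonglongrightarrow> jump_kernel u y"
        using nonneg
      proof eventually_elim
        case (elim y)
        then have "(\<lambda>n. z n y) \<longlonglongrightarrow> y"
          unfolding z_def using tendsto_max[OF tendsto_const d_lim, of y] by simp
        then show ?case
          using continuous_jump_kernel[of u] by (auto simp: continuous_on_eq_continuous_at intro: isCont_tendsto_compose)
      qed
    qed (auto simp: jump_kernel_bound)
    have "(\<lambda>n. (1 + h n) ^ Suc n) \<longlonglongrightarrow> exp (c * jump_exponent \<alpha> u)"
    proof (rule tendsto_one_plus_power_exp)
      have "of_nat (Suc n) * h n = c * (CLINT y|\<alpha>. jump_kernel u (z n y))" for n
        unfolding h_eq d_def by (simp del: of_nat_Suc)
      then show "(\<lambda>n. of_nat (Suc n) * h n) \<longlonglongrightarrow> c * jump_exponent \<alpha> u"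
        by (simp only:) (intro tendsto_intros K)
      show "h \<longlonglongrightarrow> 0"
        unfolding h_eq using tendsto_mult[OF tendsto_of_real[OF d_lim] K] by simp
    qed
    moreover have "char (S n) u = (1 + h n) ^ Suc n" for n
      unfolding S_def iid(4) by (simp add: h_def)
    ultimately show ?thesis by simp
  qed
  have "char M u = exp (c * jump_exponent \<alpha> u)" for u
  proof (rule LIMSEQ_unique)
    show "(\<lambda>n. char ((S \<circ> r) n) u) \<longlonglongrightarrow> char M u"
      using S_dist by (intro levy_continuity1 M weak) simp
    show "(\<lambda>n. char ((S \<circ> r) n) u) \<longlonglongrightarrow> exp (c * jump_exponent \<alpha> u)"
      using LIMSEQ_subseq_LIMSEQ[OF S_lim r] by (simp add: comp_def)
  qed
  then show ?thesis using M by blast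
qed

lemma infinitely_divisibleI:
  assumes \<mu>: "real_distribution \<mu>"
    and root: "\<And>n. 1 \<le> n \<Longrightarrow> \<exists>\<nu>. real_distribution \<nu> \<and> (\<forall>u. char \<mu> u = char \<nu> u ^ n)"
  shows "infinitely_divisible \<mu>"
  unfolding infinitely_divisible_def
proof (intro allI impI)
  fix n :: nat assume n: "1 \<le> n"
  then obtain \<nu> where \<nu>: "real_distribution \<nu>" and char_\<nu>: "\<And>u. char \<mu> u = char \<nu> u ^ n"
    using root by blast
  from n have "0 < n" by simp
  note iid = real_distribution.iid_coordinates[OF \<nu> this]
  let ?P = "\<Pi>\<^sub>M i\<in>{..<n}. \<nu>"
  interpret P: prob_space ?P by (rule iid(1))
  have "(\<lambda>\<omega>. \<Sum>i<n. \<omega> i) \<in> borel_measurable ?P"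
    using iid(3) unfolding P.indep_vars_def2 by (intro borel_measurable_sum) auto
  then have "distr ?P borel (\<lambda>\<omega>. \<Sum>i<n. \<omega> i) = \<mu>"
    by (intro Levy_uniqueness P.real_distribution_distr \<mu>) (simp_all add: iid(4) char_\<nu> fun_eq_iff)
  then show "\<exists>\<nu>. \<exists>(N :: (nat \<Rightarrow> real) measure) Z. prob_space N \<and> prob_space.indep_vars N (\<lambda>_. borel) Z {..<n} \<and>
      (\<forall>i<n. distr N borel (Z i) = \<nu>) \<and> distr N borel (\<lambda>\<omega>. \<Sum>i<n. Z i \<omega>) = \<mu>"
    using iid(1-3) by (intro exI[of _ \<nu>] exI[of _ ?P] exI[of _ "\<lambda>i \<omega>. \<omega> i"] conjI allI impI)
qed

text \<open>
  The \<open>n\<close>-th root of \<open>exp (a K)\<close> is \<open>exp ((a / n) K)\<close>, which is again a characteristic function of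
  the form constructed above.
\<close>

lemma (in nonneg_mean_law) infinitely_divisible_if_decomposition:
  assumes "size_bias_decomposition \<mu> N X Y"
  shows "infinitely_divisible \<mu>"
proof (rule infinitely_divisibleI[OF real_distribution_axioms])
  fix n :: nat assume n: "1 \<le> n"
  let ?\<alpha> = "distr N borel Y"
  note \<alpha> = size_bias_decomposition_char[OF assms]
  have [measurable]: "Y \<in> borel_measurable N"
    using assms prob_space.indep_var_rv2 by (auto simp: size_bias_decomposition_def)
  have "AE y in ?\<alpha>. 0 \<le> y"
    using size_bias_decomposition_nonneg[OF assms] by (simp add: AE_distr_iff)
  then obtain \<nu> where "real_distribution \<nu>" 
    and "\<And>u. char \<nu> u = exp (complex_of_real (a / n) * jump_exponent ?\<alpha> u)"
    using exp_jump_exponent_is_char[OF \<alpha>(1), of "a / n"] mean_pos n by auto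
  moreover from this(2) have "char \<mu> u = char \<nu> u ^ n" for u
    using n by (simp add: char_eq_exp_jump_exponent[OF \<alpha>] flip: exp_of_nat_mult)
  ultimately show "\<exists>\<nu>. real_distribution \<nu> \<and> (\<forall>u. char \<mu> u = char \<nu> u ^ n)"
    by blast
qed

section \<open>Roots of an infinitely divisible law\<close>

lemma (in real_distribution) small_upper_tail:
  assumes "0 < e" shows "\<exists>b. measure M {b<..} < e"
proof -
  have "\<forall>\<^sub>F b in at_top. 1 - e < cdf M b"
    using order_tendstoD(1)[OF cdf_lim_at_top_prob] assms by simp
  then obtain b where "1 - e < cdf M b"
    by (auto simp: eventually_at_top_linorder)
  moreover have "measure M {b<..} = 1 - cdf M b"
    using prob_compl[of "{..b}"] by (simp add: cdf_def Compl_eq_Diff_UNIV[symmetric])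
  ultimately show ?thesis by (intro exI[of _ b]) simp
qed

lemma (in nonneg_mean_law) size_biased_tail:
  "measure (size_biased \<mu>) {t<..} = (\<integral>x. x * indicator {t<..} x \<partial>\<mu>) / a"
  using integral_size_biased[of "indicator {t<..} :: real \<Rightarrow> real"]
  by (simp add: divide_inverse mult.commute size_biased_def)

lemma (in nonneg_mean_law) norm_char_minus_1: "cmod (char \<mu> u - 1) \<le> \<bar>u\<bar> * a"
proof -
  have int: "complex_integrable \<mu> (\<lambda>x. iexp (u * x))"
    by (rule integrable_iexp) auto
  have "char \<mu> u - 1 = (CLINT x|\<mu>. iexp (u * x) - 1)"
    using prob_space int by (simp add: char_def)
  also have "cmod \<dots> \<le> (\<integral>x. cmod (iexp (u * x) - 1) \<partial>\<mu>)"
    by (rule integral_norm_bound)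
  also have "\<dots> \<le> (\<integral>x. \<bar>u\<bar> * x \<partial>\<mu>)"
  proof (rule integral_mono_AE)
    show "AE x in \<mu>. cmod (iexp (u * x) - 1) \<le> \<bar>u\<bar> * x"
      using nonneg
    proof eventually_elim
      case (elim x)
      then show ?case using iexp_lipschitz[of u x 0] by simp
    qed
    show "integrable \<mu> (\<lambda>x. cmod (iexp (u * x) - 1))"
      using int by (intro integrable_norm Bochner_Integration.integrable_diff) auto
  qed (simp add: integrable_id)
  finally show ?thesis by (simp add: mean)
qed

text \<open>
  Roots of a nonnegative law are nonnegative, since otherwise all summands could be negative at once.
  The tail bound, which yields tightness later, comes from size biasing one summand \<open>Z\<^sub>i\<close> of
  the sum \<open>S\<close>: as \<open>Z\<^sub>i \<le> S\<close>, the sum of \<open>Z\<^sub>i 1{Z\<^sub>i > t}\<close> is at most \<open>S 1{S > t}\<close>.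
\<close>

lemma (in nonneg_mean_law) infinitely_divisible_root:
  assumes "infinitely_divisible \<mu>" and n: "0 < n"
  obtains \<nu> where "nonneg_mean_law \<nu> (a / real n)" "\<And>u. char \<mu> u = char \<nu> u ^ n"
    "\<And>t. measure (size_biased \<nu>) {t<..} \<le> measure (size_biased \<mu>) {t<..}"
proof -
  have "1 \<le> n" using n by simp
  then obtain \<nu> and N :: "(nat \<Rightarrow> real) measure" and Z where "prob_space N"
    and "prob_space.indep_vars N (\<lambda>_. borel) Z {..<n}"
    and Z_law: "\<And>i. i < n \<Longrightarrow> distr N borel (Z i) = \<nu>"
    and sum_law: "distr N borel (\<lambda>\<omega>. \<Sum>i<n. Z i \<omega>) = \<mu>"
    using assms(1) unfolding infinitely_divisible_def by metis
  then interpret N: prob_space N by simp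
  have ind: "N.indep_vars (\<lambda>_. borel) Z {..<n}" by fact
  have Z_meas: "Z i \<in> borel_measurable N" if "i < n" for i
    using ind that unfolding N.indep_vars_def2 by auto
  define S where "S \<omega> = (\<Sum>i<n. Z i \<omega>)" for \<omega>
  have S_meas [measurable]: "S \<in> borel_measurable N"
    unfolding S_def by (intro borel_measurable_sum Z_meas) auto
  have S_law: "distr N borel S = \<mu>"
    using sum_law by (simp add: S_def[abs_def])
  have \<nu>_dist: "real_distribution \<nu>"
    using N.real_distribution_distr[OF Z_meas[OF n]] by (simp add: Z_law n)
  interpret \<nu>: real_distribution \<nu> by (rule \<nu>_dist)
  have S_int: "integrable N S" and S_mean: "(\<integral>\<omega>. S \<omega> \<partial>N) = a"
    using integrable_id mean unfolding S_law[symmetric] by (simp_all add: integrable_distr_eq integral_distr)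
  have S_nonneg: "AE \<omega> in N. 0 \<le> S \<omega>"
    using nonneg unfolding S_law[symmetric] by (simp add: AE_distr_iff)

  have \<nu>_nonneg: "AE x in \<nu>. 0 \<le> x"
  proof -
    have "N.prob (\<Inter>i\<in>{..<n}. Z i -` {..<0} \<inter> space N) = (\<Prod>i<n. N.prob (Z i -` {..<0} \<inter> space N))"
      using n by (intro N.indep_varsD_finite[OF ind]) auto
    also have "\<dots> = measure \<nu> {..<0} ^ n"
    proof -
      have "N.prob (Z i -` {..<0} \<inter> space N) = measure \<nu> {..<0}" if "i < n" for i
        using measure_distr[OF Z_meas[OF that], of "{..<0}"] by (simp add: Z_law that)
      then show ?thesis by simp
    qed
    also have "N.prob (\<Inter>i\<in>{..<n}. Z i -` {..<0} \<inter> space N) = 0"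
    proof (subst N.prob_eq_0)
      show "(\<Inter>i\<in>{..<n}. Z i -` {..<0} \<inter> space N) \<in> N.events"
        using n Z_meas by (intro sets.finite_INT measurable_sets) auto
      show "AE \<omega> in N. \<omega> \<notin> (\<Inter>i\<in>{..<n}. Z i -` {..<0} \<inter> space N)"
        using S_nonneg
      proof eventually_elim
        case (elim \<omega>)
        have "S \<omega> < 0" if "\<forall>i<n. Z i \<omega> < 0"
          unfolding S_def using sum_strict_mono[of "{..<n}" "\<lambda>i. Z i \<omega>" "\<lambda>_. 0"] that n by auto
        then show ?case using elim by (fastforce simp: not_less[symmetric])
      qed
    qed
    finally have "measure \<nu> {..<0} = 0" using n by simp
    then show ?thesis
      by (subst AE_iff_measurable[OF _ refl]) (auto simp: \<nu>.emeasure_eq_measure not_le lessThan_def)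
  qed
  have Z_nonneg: "AE \<omega> in N. \<forall>i\<in>{..<n}. 0 \<le> Z i \<omega>"
  proof (subst AE_finite_all)
    show "\<forall>i\<in>{..<n}. AE \<omega> in N. 0 \<le> Z i \<omega>"
    proof
      fix i assume "i \<in> {..<n}"
      then have law: "distr N borel (Z i) = \<nu>" by (simp add: Z_law)
      have "AE x in distr N borel (Z i). 0 \<le> x" unfolding law by (rule \<nu>_nonneg)
      then show "AE \<omega> in N. 0 \<le> Z i \<omega>"
        using \<open>i \<in> {..<n}\<close> by (subst (asm) AE_distr_iff) (auto intro: Z_meas)
    qed
  qed simp
  have Z_le_S: "AE \<omega> in N. \<forall>i\<in>{..<n}. 0 \<le> Z i \<omega> \<and> Z i \<omega> \<le> S \<omega>"
    using Z_nonneg by eventually_elim (auto simp: S_def intro!: member_le_sum)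
  have Z_int: "integrable N (Z i)" if "i < n" for i
    using S_int by (rule Bochner_Integration.integrable_bound)
      (use Z_meas that Z_le_S in \<open>auto elim!: eventually_mono dest!: bspec[of _ _ i]\<close>)
  have transfer: "(\<integral>\<omega>. g (Z i \<omega>) \<partial>N) = (\<integral>x. g x \<partial>\<nu>)"
    if "i < n" "g \<in> borel_measurable borel" for i and g :: "real \<Rightarrow> real"
    using integral_distr[OF Z_meas[OF that(1)] that(2)] by (simp add: Z_law that)
  have \<nu>_int: "integrable \<nu> (\<lambda>x. x)"
    using Z_int[OF n] integrable_distr_eq[OF Z_meas[OF n], of "\<lambda>x. x"] by (simp add: Z_law n)
  have "a = (\<Sum>i<n. \<integral>\<omega>. Z i \<omega> \<partial>N)"
    unfolding S_mean[symmetric] S_def using Z_int by (intro Bochner_Integration.integral_sum) auto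
  also have "\<dots> = real n * (\<integral>x. x \<partial>\<nu>)"
    using transfer[of _ "\<lambda>x. x"] by simp
  finally have \<nu>_mean: "(\<integral>x. x \<partial>\<nu>) = a / n"
    using n by (simp add: field_simps)
  interpret \<nu>: nonneg_mean_law \<nu> "a / n"
    using \<nu>_nonneg \<nu>_int \<nu>_mean mean_pos n by unfold_locales auto
  show thesis
  proof (rule that)
    show "nonneg_mean_law \<nu> (a / n)" ..
    show "char \<mu> u = char \<nu> u ^ n" for u
      using N.char_distr_sum[OF ind, of u] by (simp add: sum_law Z_law)
    fix t
    let ?I = "indicator {t<..} :: real \<Rightarrow> real"
    have "real n * (\<integral>x. x * ?I x \<partial>\<nu>) = (\<Sum>i<n. \<integral>\<omega>. Z i \<omega> * ?I (Z i \<omega>) \<partial>N)"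
      using transfer[of _ "\<lambda>x. x * ?I x"] by simp
    also have "\<dots> = (\<integral>\<omega>. (\<Sum>i<n. Z i \<omega> * ?I (Z i \<omega>)) \<partial>N)"
    proof (rule Bochner_Integration.integral_sum[symmetric])
      fix i assume "i \<in> {..<n}"
      then show "integrable N (\<lambda>\<omega>. Z i \<omega> * ?I (Z i \<omega>))"
        using Z_meas by (intro Bochner_Integration.integrable_bound[OF Z_int[of i]])
          (auto simp: indicator_def)
    qed
    also have "\<dots> \<le> (\<integral>\<omega>. S \<omega> * ?I (S \<omega>) \<partial>N)"
    proof (rule integral_mono_AE)
      show "AE \<omega> in N. (\<Sum>i<n. Z i \<omega> * ?I (Z i \<omega>)) \<le> S \<omega> * ?I (S \<omega>)"
        using Z_le_S
      proof eventually_elim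
        case (elim \<omega>)
        \<comment> \<open>if one summand exceeds \<open>t\<close>, so does the sum\<close>
        have "(\<Sum>i<n. Z i \<omega> * ?I (Z i \<omega>)) \<le> (\<Sum>i<n. Z i \<omega> * ?I (S \<omega>))"
          using elim by (intro sum_mono mult_left_mono) (auto simp: indicator_def dest: bspec)
        then show ?case by (simp add: S_def sum_distrib_right)
      qed
      show "integrable N (\<lambda>\<omega>. \<Sum>i<n. Z i \<omega> * ?I (Z i \<omega>))"
        using Z_meas by (intro Bochner_Integration.integrable_sum Bochner_Integration.integrable_bound[OF Z_int])
          (auto simp: indicator_def)
      show "integrable N (\<lambda>\<omega>. S \<omega> * ?I (S \<omega>))"
        by (intro Bochner_Integration.integrable_bound[OF S_int]) (auto simp: indicator_def)
    qed
    also have "\<dots> = (\<integral>x. x * ?I x \<partial>\<mu>)"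
      unfolding S_law[symmetric] by (simp add: integral_distr)
    finally show "measure (size_biased \<nu>) {t<..} \<le> measure (size_biased \<mu>) {t<..}"
      unfolding size_biased_tail \<nu>.size_biased_tail using mean_pos n
      by (simp add: field_simps)
  qed
qed

text \<open>
  A sum of \<open>n\<close> i.i.d. variables is size biased by size biasing one summand.  In terms of characteristic
  functions this is the chain rule for the \<open>n\<close>-th power; multiplying by \<open>char \<nu>\<close> restores the missing
  summand.
\<close>

lemma (in nonneg_mean_law) char_size_biased_of_root:
  assumes "nonneg_mean_law \<nu> (a / real n)" and n: "0 < n" and root: "\<And>u. char \<mu> u = char \<nu> u ^ n"
  shows "char (size_biased \<mu>) u * char \<nu> u = char \<mu> u * char (size_biased \<nu>) u"
proof -
  interpret \<nu>: nonneg_mean_law \<nu> "a / n" by fact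
  have "((\<lambda>z. z ^ n) has_field_derivative of_nat n * char \<nu> u ^ (n - 1)) (at (char \<nu> u))"
    by (auto intro!: derivative_eq_intros)
  from field_vector_diff_chain_at[OF \<nu>.char_derivative_size_biased this]
  have "(char \<mu> has_vector_derivative
      \<i> * (a / n) * char (size_biased \<nu>) u * (of_nat n * char \<nu> u ^ (n - 1))) (at u)"
    by (simp add: comp_def root[symmetric])
  then have "\<i> * a * char (size_biased \<mu>) u =
      \<i> * (a / n) * char (size_biased \<nu>) u * (of_nat n * char \<nu> u ^ (n - 1))"
    by (rule vector_derivative_unique_at[OF char_derivative_size_biased])
  then have "char (size_biased \<mu>) u = char (size_biased \<nu>) u * char \<nu> u ^ (n - 1)"
    using mean_pos n by (simp add: field_simps)
  moreover have "char \<nu> u ^ n = char \<nu> u ^ (n - 1) * char \<nu> u"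
    using n by (cases n) auto
  ultimately show ?thesis by (simp add: root)
qed

text \<open>
  \<open>\<alpha>\<close> is a weak limit of the size biased roots, whose tails are dominated by the size biased tail of
  \<open>\<mu>\<close>.  The roots themselves have means \<open>a / n\<close> and vanish in the limit, so replacing a root by its
  size biased version amounts to adding an independent variable with law \<open>\<alpha>\<close>.
\<close>

lemma (in nonneg_mean_law) size_bias_factor_if_infinitely_divisible:
  assumes "infinitely_divisible \<mu>"
  obtains \<alpha> where "real_distribution \<alpha>" "\<And>u. char (size_biased \<mu>) u = char \<mu> u * char \<alpha> u"
proof -
  have "\<exists>\<nu>. nonneg_mean_law \<nu> (a / Suc n) \<and> (\<forall>u. char \<mu> u = char \<nu> u ^ Suc n) \<and>
      (\<forall>t. measure (size_biased \<nu>) {t<..} \<le> measure (size_biased \<mu>) {t<..})" for n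
    by (rule infinitely_divisible_root[OF assms zero_less_Suc, of n]) blast
  then obtain \<nu> where \<nu>: "\<And>n. nonneg_mean_law (\<nu> n) (a / Suc n)"
    and root: "\<And>n u. char \<mu> u = char (\<nu> n) u ^ Suc n"
    and tail: "\<And>n t. measure (size_biased (\<nu> n)) {t<..} \<le> measure (size_biased \<mu>) {t<..}"
    by metis
  define \<sigma> where "\<sigma> n = size_biased (\<nu> n)" for n
  have \<sigma>: "real_distribution (\<sigma> n)" for n
    unfolding \<sigma>_def by (rule nonneg_mean_law.real_distribution_size_biased[OF \<nu>])
  have "tight \<sigma>"
  proof (rule tight_nonneg[OF \<sigma>])
    show "AE x in \<sigma> n. 0 \<le> x" for n
      unfolding \<sigma>_def
      by (intro nonneg_mean_law.AE_size_biased[OF \<nu>] nonneg_mean_law.nonneg[OF \<nu>])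
    show "\<exists>b. \<forall>n. measure (\<sigma> n) {b<..} < e" if "0 < e" for e
      using real_distribution.small_upper_tail[OF real_distribution_size_biased that] tail
      unfolding \<sigma>_def by (meson le_less_trans)
  qed
  then obtain r \<alpha> where r: "strict_mono r" and \<alpha>: "real_distribution \<alpha>"
    and weak: "weak_conv_m (\<sigma> \<circ> r) \<alpha>"
    using tight_imp_convergent_subsubsequence[of \<sigma> id] by (auto simp: strict_mono_id)
  show thesis
  proof (rule that[OF \<alpha>])
    fix u
    have "(\<lambda>n. char (\<nu> n) u - 1) \<longlonglongrightarrow> 0"
    proof (rule Lim_null_comparison)
      show "\<forall>\<^sub>F n in sequentially. cmod (char (\<nu> n) u - 1) \<le> \<bar>u\<bar> * (a / Suc n)"
        using nonneg_mean_law.norm_char_minus_1[OF \<nu>] by simp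
      show "(\<lambda>n. \<bar>u\<bar> * (a / Suc n)) \<longlonglongrightarrow> 0"
        using tendsto_mult_right_zero[OF LIMSEQ_Suc[OF lim_const_over_n[of a]]] by simp
    qed
    then have "(\<lambda>n. char (\<nu> n) u) \<longlonglongrightarrow> 1"
      by (simp add: LIM_zero_iff)
    then have "(\<lambda>n. char (size_biased \<mu>) u * char (\<nu> (r n)) u) \<longlonglongrightarrow> char (size_biased \<mu>) u * 1"
      using LIMSEQ_subseq_LIMSEQ[OF _ r] by (intro tendsto_intros) (auto simp: comp_def)
    moreover have "(\<lambda>n. char \<mu> u * char (\<sigma> (r n)) u) \<longlonglongrightarrow> char \<mu> u * char \<alpha> u"
      using levy_continuity1[OF _ \<alpha> weak] \<sigma> by (intro tendsto_intros) (simp add: comp_def)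
    moreover have "char (size_biased \<mu>) u * char (\<nu> n) u = char \<mu> u * char (\<sigma> n) u" for n
      unfolding \<sigma>_def by (intro char_size_biased_of_root[OF \<nu>] root) simp
    ultimately show "char (size_biased \<mu>) u = char \<mu> u * char \<alpha> u"
      using LIMSEQ_unique by fastforce
  qed
qed

lemma (in nonneg_mean_law) size_bias_decomposition_product:
  assumes \<alpha>: "real_distribution \<alpha>"
    and factor: "\<And>u. char (size_biased \<mu>) u = char \<mu> u * char \<alpha> u"
  shows "size_bias_decomposition \<mu> (\<mu> \<Otimes>\<^sub>M \<alpha>) fst snd"
proof -
  interpret \<alpha>: real_distribution \<alpha> by fact
  interpret P: pair_prob_space \<mu> \<alpha> ..
  have fst_law: "distr (\<mu> \<Otimes>\<^sub>M \<alpha>) borel fst = \<mu>"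
  proof -
    have "distr (\<mu> \<Otimes>\<^sub>M \<alpha>) borel fst = distr (\<mu> \<Otimes>\<^sub>M \<alpha>) \<mu> fst"
      by (intro distr_cong) auto
    then show ?thesis by (simp add: \<alpha>.distr_pair_fst)
  qed
  have snd_law: "distr (\<mu> \<Otimes>\<^sub>M \<alpha>) borel snd = \<alpha>"
  proof -
    have "distr (\<mu> \<Otimes>\<^sub>M \<alpha>) borel snd = distr (\<mu> \<Otimes>\<^sub>M \<alpha>) \<alpha> snd"
      by (intro distr_cong) auto
    also have "\<dots> = distr (distr (\<alpha> \<Otimes>\<^sub>M \<mu>) (\<mu> \<Otimes>\<^sub>M \<alpha>) (\<lambda>(x, y). (y, x))) \<alpha> snd"
      by (subst P.distr_pair_swap) simp
    also have "\<dots> = distr (\<alpha> \<Otimes>\<^sub>M \<mu>) \<alpha> fst"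
      by (subst distr_distr) (auto simp: comp_def case_prod_beta)
    finally show ?thesis by (simp add: distr_pair_fst)
  qed
  have pair_sets: "sets (borel \<Otimes>\<^sub>M borel) = sets (\<mu> \<Otimes>\<^sub>M \<alpha>)"
    by (intro sets_pair_measure_cong) auto
  have [measurable]: "fst \<in> borel_measurable (\<mu> \<Otimes>\<^sub>M \<alpha>)" "snd \<in> borel_measurable (\<mu> \<Otimes>\<^sub>M \<alpha>)"
    by (auto cong: measurable_cong_sets simp flip: pair_sets)
  have ind: "P.indep_var borel fst borel snd"
    unfolding P.indep_var_distribution_eq fst_law snd_law
    using distr_cong[OF refl pair_sets, of "\<mu> \<Otimes>\<^sub>M \<alpha>" "\<lambda>x. x" "\<lambda>x. (fst x, snd x)"]
    by (simp add: distr_id2)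
  have "size_biased \<mu> = distr (\<mu> \<Otimes>\<^sub>M \<alpha>) borel (\<lambda>\<omega>. fst \<omega> + snd \<omega>)"
    using P.char_distr_add[OF ind]
    by (intro Levy_uniqueness real_distribution_size_biased P.real_distribution_distr)
      (auto simp: fst_law snd_law factor)
  then show ?thesis
    by (simp add: size_bias_decomposition_def ind fst_law P.prob_space_axioms)
qed

section \<open>Characterization of infinitely divisible laws with finite mean\<close>

theorem theorem11p2:
  fixes M :: "'a measure" and X :: "'a \<Rightarrow> real" and a :: real and \<mu> :: "real measure"
  assumes "prob_space M"
    and "X \<in> borel_measurable M"
    and "AE \<omega> in M. 0 \<le> X \<omega>"
    and "integrable M X"
    and "a = (\<integral>\<omega>. X \<omega> \<partial>M)"
    and "0 < a"
    and "\<mu> = distr M borel X"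
  shows
    "(infinitely_divisible \<mu> \<longrightarrow>
        (\<exists>(N :: (real \<times> real) measure) X' Y. size_bias_decomposition \<mu> N X' Y)) \<and>
     (\<forall>(N :: 'b measure) X' Y. size_bias_decomposition \<mu> N X' Y \<longrightarrow> infinitely_divisible \<mu>) \<and>
     (\<forall>(N\<^sub>1 :: 'b measure) X\<^sub>1 Y\<^sub>1 (N\<^sub>2 :: 'c measure) X\<^sub>2 Y\<^sub>2.
        size_bias_decomposition \<mu> N\<^sub>1 X\<^sub>1 Y\<^sub>1 \<and> size_bias_decomposition \<mu> N\<^sub>2 X\<^sub>2 Y\<^sub>2 \<longrightarrow>
        distr N\<^sub>1 borel Y\<^sub>1 = distr N\<^sub>2 borel Y\<^sub>2) \<and>
     (\<forall>(N :: 'b measure) X' Y (\<alpha> :: real measure).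
        size_bias_decomposition \<mu> N X' Y \<and> \<alpha> = distr N borel Y \<longrightarrow>
        measure N {\<omega> \<in> space N. 0 \<le> Y \<omega>} = 1 \<and>
        (\<forall>u :: real. char \<mu> u =
           exp (complex_of_real a *
             (\<i> * complex_of_real u * complex_of_real (measure \<alpha> {0}) +
              (CLINT y:{0<..}|\<alpha>. (iexp (u * y) - 1) / complex_of_real y)))))"
proof -
  note [measurable] = assms(2)
  interpret nonneg_mean_law \<mu> a
  proof (intro nonneg_mean_law.intro nonneg_mean_law_axioms.intro)
    show "real_distribution \<mu>"
      unfolding assms(7) by (rule prob_space.real_distribution_distr[OF assms(1,2)])
    show "AE x in \<mu>. 0 \<le> x" "integrable \<mu> (\<lambda>x. x)" "(\<integral>x. x \<partial>\<mu>) = a" "0 < a"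
      using assms(3-6) unfolding assms(7) by (simp_all add: AE_distr_iff integrable_distr_eq integral_distr)
  qed
  show ?thesis
  proof (intro conjI allI impI)
    assume "infinitely_divisible \<mu>"
    then obtain \<alpha> where "real_distribution \<alpha>" "\<And>u. char (size_biased \<mu>) u = char \<mu> u * char \<alpha> u"
      by (rule size_bias_factor_if_infinitely_divisible) blast
    then show "\<exists>(N :: (real \<times> real) measure) X' Y. size_bias_decomposition \<mu> N X' Y"
      using size_bias_decomposition_product by blast
  next
    fix N :: "'b measure" and X' Y
    assume "size_bias_decomposition \<mu> N X' Y"
    then show "infinitely_divisible \<mu>" by (rule infinitely_divisible_if_decomposition)
  next
    fix N\<^sub>1 :: "'b measure" and X\<^sub>1 Y\<^sub>1 and N\<^sub>2 :: "'c measure" and X\<^sub>2 Y\<^sub>2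
    assume "size_bias_decomposition \<mu> N\<^sub>1 X\<^sub>1 Y\<^sub>1 \<and> size_bias_decomposition \<mu> N\<^sub>2 X\<^sub>2 Y\<^sub>2"
    then show "distr N\<^sub>1 borel Y\<^sub>1 = distr N\<^sub>2 borel Y\<^sub>2"
      by (intro size_bias_factor_unique) (auto intro: size_bias_decomposition_char)
  next
    fix N :: "'b measure" and X' Y \<alpha>
    assume "size_bias_decomposition \<mu> N X' Y \<and> \<alpha> = distr N borel Y"
    then have decomp: "size_bias_decomposition \<mu> N X' Y" and \<alpha>_eq: "\<alpha> = distr N borel Y"
      by auto
    interpret N: prob_space N
      using decomp by (simp add: size_bias_decomposition_def)
    have [measurable]: "Y \<in> borel_measurable N"
      using decomp N.indep_var_rv2 by (auto simp: size_bias_decomposition_def)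
    have Y: "AE \<omega> in N. 0 \<le> Y \<omega>"
      by (rule size_bias_decomposition_nonneg[OF decomp])
    then show "measure N {\<omega> \<in> space N. 0 \<le> Y \<omega>} = 1"
      by (subst N.prob_Collect_eq_1) auto
    fix u
    note \<alpha> = size_bias_decomposition_char[OF decomp, folded \<alpha>_eq]
    have "AE y in \<alpha>. 0 \<le> y"
      using Y unfolding \<alpha>_eq by (simp add: AE_distr_iff)
    then show "char \<mu> u = exp (complex_of_real a *
             (\<i> * complex_of_real u * complex_of_real (measure \<alpha> {0}) +
              (CLINT y:{0<..}|\<alpha>. (iexp (u * y) - 1) / complex_of_real y)))"
      using char_eq_exp_jump_exponent[OF \<alpha>] real_distribution.jump_exponent_nonneg[OF \<alpha>(1)] by simp
  qed
qed

end
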